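(* Let $(X,\mu)$ be a non-atomic Lebesgue space with a positive finite measure, and let $T:X\to X$ be nonsingular. If $(X,\mu,T)$ is lightly mixing, then $T$ is measurably sensitive.
   Context: $T$ is nonsingular if it is measurable and, for measurable $A$, $\mu(A)=0$ if and only if $\mu(T^{-1}(A))=0$. A system $(X,\mu,T)$ on a finite measure space is lightly mixing if $\liminf_{n\to\infty}\mu(T^{-n}(A)\cap B)>0$ for all sets $A$ and $B$ of positive measure. A metric $d$ on a measure space is good if all nonempty open sets have positive measure; when a space carries a good metric, the measure on it is assumed to be regular (so open sets are measurable). $B_\varepsilon(x)$ denotes the open $d$-ball of radius $\varepsilon$ about $x$. Two systems $(X,\mu,T)$ and $(X_1,\mu_1,T_1)$ are measure-theoretically isomorphic if, after discarding null sets (with forward-invariant complements), there is a bimeasurable bijection between them that carries $\mu$ to $\mu_1$ and intertwines $T$ and $T_1$. $T$ is measurably sensitive if whenever $(X_1,\mu_1,T_1)$ is measure-theoretically isomorphic to $(X,\mu,T)$ and $d$ is a good metric on $X_1$, there exists $\delta>0$ such that for all $x\in X_1$ and all $\varepsilon>0$ there exists $N\in\mathbb{N}$ such that for all integers $n\ge N$, $\mu_1\{y\in B_\varepsilon(x): d(T_1^n(x),T_1^n(y))>\delta\}>0$. *)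

theory Defs
  imports "HOL-Analysis.Analysis"
begin

definition isomorphism_mod0 ::
    "'a measure \<Rightarrow> 'b measure \<Rightarrow> 'a set \<Rightarrow> 'b set \<Rightarrow> ('a \<Rightarrow> 'b) \<Rightarrow> bool" where
  "isomorphism_mod0 M N X0 Y0 \<phi> \<longleftrightarrow>
     X0 \<subseteq> space M \<and> space M - X0 \<in> null_sets M \<and>
     Y0 \<subseteq> space N \<and> space N - Y0 \<in> null_sets N \<and>
     bij_betw \<phi> X0 Y0 \<and>
     \<phi> \<in> measurable (restrict_space M X0) (restrict_space N Y0) \<and>
     the_inv_into X0 \<phi> \<in> measurable (restrict_space N Y0) (restrict_space M X0) \<and>
     distr (restrict_space M X0) (restrict_space N Y0) \<phi> = restrict_space N Y0"

text \<open>A Lebesgue space is a complete measure space which, modulo null sets, consists of an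
  interval carrying Lebesgue measure together with countably many further points (the atoms).
  The interval may be empty, degenerate or unbounded.\<close>

definition lebesgue_space :: "'a measure \<Rightarrow> bool" where
  "lebesgue_space M \<longleftrightarrow>
     complete_measure M \<and>
     (\<exists>D (I :: real set) X0 Y0 \<phi>.
        countable D \<and> D \<subseteq> space M \<and> (\<forall>p\<in>D. {p} \<in> sets M) \<and> is_interval I \<and>
        isomorphism_mod0 (restrict_space M (space M - D)) (lebesgue_on I) X0 Y0 \<phi>)"

definition non_atomic :: "'a measure \<Rightarrow> bool" where
  "non_atomic M \<longleftrightarrow>
     \<not> (\<exists>A\<in>sets M. emeasure M A > 0 \<and>
          (\<forall>B\<in>sets M. B \<subseteq> A \<longrightarrow> emeasure M B = 0 \<or> emeasure M (A - B) = 0))"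

definition nonsingular :: "'a measure \<Rightarrow> ('a \<Rightarrow> 'a) \<Rightarrow> bool" where
  "nonsingular M T \<longleftrightarrow>
     T \<in> measurable M M \<and>
     (\<forall>A\<in>sets M. emeasure M A = 0 \<longleftrightarrow> emeasure M (T -` A \<inter> space M) = 0)"

definition lightly_mixing :: "'a measure \<Rightarrow> ('a \<Rightarrow> 'a) \<Rightarrow> bool" where
  "lightly_mixing M T \<longleftrightarrow>
     (\<forall>A\<in>sets M. \<forall>B\<in>sets M. emeasure M A > 0 \<longrightarrow> emeasure M B > 0 \<longrightarrow>
        liminf (\<lambda>n. emeasure M (((T ^^ n) -` A \<inter> space M) \<inter> B)) > 0)"

definition isomorphic_systems ::
    "'a measure \<Rightarrow> ('a \<Rightarrow> 'a) \<Rightarrow> 'b measure \<Rightarrow> ('b \<Rightarrow> 'b) \<Rightarrow> bool" where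
  "isomorphic_systems M T M1 T1 \<longleftrightarrow>
     (\<exists>X0 Y0 \<phi>. isomorphism_mod0 M M1 X0 Y0 \<phi> \<and>
        T ` X0 \<subseteq> X0 \<and> T1 ` Y0 \<subseteq> Y0 \<and> (\<forall>x\<in>X0. \<phi> (T x) = T1 (\<phi> x)))"

text \<open>Inner regularity is by closed sets. This is implied by inner regularity by compact sets, so
  assuming it is the weaker requirement. The underlying sigma-algebra may be larger than the Borel
  one, so this is a genuine condition even for finite measures on a metric space.\<close>

definition regular_measure :: "'a topology \<Rightarrow> 'a measure \<Rightarrow> bool" where
  "regular_measure \<tau> M \<longleftrightarrow>
     (\<forall>U. openin \<tau> U \<longrightarrow> U \<in> sets M) \<and>
     (\<forall>A\<in>sets M. \<forall>e>0. \<exists>C U. closedin \<tau> C \<and> openin \<tau> U \<and> C \<subseteq> A \<and> A \<subseteq> U \<and>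
        emeasure M (U - C) < e)"

text \<open>The standing assumption that the measure is regular whenever the space carries a good metric
  is part of the definition.\<close>

definition good_metric :: "'a measure \<Rightarrow> ('a \<Rightarrow> 'a \<Rightarrow> real) \<Rightarrow> bool" where
  "good_metric M d \<longleftrightarrow>
     Metric_space (space M) d \<and>
     regular_measure (Metric_space.mtopology (space M) d) M \<and>
     (\<forall>U. openin (Metric_space.mtopology (space M) d) U \<longrightarrow> U \<noteq> {} \<longrightarrow> emeasure M U > 0)"

text \<open>A definition cannot quantify over types, so the type on which the isomorphic systems
  live is a parameter; a statement with this type variable free speaks about all of them.\<close>

definition measurably_sensitive ::
    "'b itself \<Rightarrow> 'a measure \<Rightarrow> ('a \<Rightarrow> 'a) \<Rightarrow> bool" where
  "measurably_sensitive (_ :: 'b itself) M T \<longleftrightarrow>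
     (\<forall>(M1 :: 'b measure) T1 d.
        nonsingular M1 T1 \<longrightarrow> isomorphic_systems M T M1 T1 \<longrightarrow> good_metric M1 d \<longrightarrow>
        (\<exists>\<delta>>0. \<forall>x\<in>space M1. \<forall>\<epsilon>>0. \<exists>N::nat. \<forall>n\<ge>N.
           emeasure M1 {y \<in> Metric_space.mball (space M1) d x \<epsilon>.
                          d ((T1 ^^ n) x) ((T1 ^^ n) y) > \<delta>} > 0))"

end

theory Submission
  imports Defs
begin

text \<open>Fix two distinct points and let \<open>U\<close>, \<open>V\<close> be the balls about them whose radius \<open>\<delta>\<close> is a
  quarter of their distance, so that no point is within \<open>\<delta>\<close> of both \<open>U\<close> and \<open>V\<close>. By light mixing,
  which passes to isomorphic systems, for all large \<open>n\<close> positive-measure parts of a given ball about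
  \<open>x\<close> are carried into \<open>U\<close> and into \<open>V\<close> by the \<open>n\<close>-th iterate. Wherever that iterate sends \<open>x\<close>, it
  is at distance greater than \<open>\<delta>\<close> from all of \<open>U\<close> or from all of \<open>V\<close>.\<close>

lemma conull_in_sets:
  assumes "X0 \<subseteq> space M" "space M - X0 \<in> null_sets M"
  shows "X0 \<in> sets M"
proof -
  have "X0 = space M - (space M - X0)" using assms(1) by blast
  then show ?thesis using assms(2) by (metis null_setsD2 sets.compl_sets)
qed

text \<open>The image-measure identity between the restricted spaces applies to
  \<open>C \<inter> Y0\<close>; the rest of \<open>C\<close> lies in the null set
  \<open>space N - Y0\<close>.\<close>

lemma isomorphism_mod0_vimage:
  assumes iso: "isomorphism_mod0 M N X0 Y0 \<phi>" and C: "C \<in> sets N"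
  shows "\<phi> -` C \<inter> X0 \<in> sets M"
    and "emeasure M (\<phi> -` C \<inter> X0) = emeasure N C"
proof -
  let ?M = "restrict_space M X0" and ?N = "restrict_space N Y0"
  have XM: "X0 \<in> sets M" and YN: "Y0 \<in> sets N"
    using iso by (auto simp: isomorphism_mod0_def intro: conull_in_sets)
  have meas: "\<phi> \<in> measurable ?M ?N"
    and img: "\<phi> ` X0 = Y0" and dis: "distr ?M ?N \<phi> = ?N" and null: "space N - Y0 \<in> null_sets N"
    using iso by (auto simp: isomorphism_mod0_def bij_betw_def)
  have sp: "space ?M = X0"
    using XM sets.sets_into_space by (fastforce simp: space_restrict_space)
  have CY: "C \<inter> Y0 \<in> sets ?N"
    using C YN by (auto simp: sets_restrict_space)
  have eq: "\<phi> -` (C \<inter> Y0) \<inter> space ?M = \<phi> -` C \<inter> X0"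
    using img sp by auto
  have in_sets: "\<phi> -` C \<inter> X0 \<in> sets ?M"
    using measurable_sets[OF meas CY] eq by simp
  then show "\<phi> -` C \<inter> X0 \<in> sets M"
    using XM by (simp add: sets_restrict_space_iff)
  have "emeasure M (\<phi> -` C \<inter> X0) = emeasure ?M (\<phi> -` C \<inter> X0)"
    using XM by (simp add: emeasure_restrict_space)
  also have "\<dots> = emeasure (distr ?M ?N \<phi>) (C \<inter> Y0)"
    using emeasure_distr[OF meas CY] eq by simp
  also have "\<dots> = emeasure N (C \<inter> Y0)"
    using YN by (simp add: dis emeasure_restrict_space)
  also have "\<dots> = emeasure N (C - (space N - Y0))"
    using C sets.sets_into_space by (intro arg_cong[where f = "emeasure N"]) fastforce
  also have "\<dots> = emeasure N C"
    using null C by (rule emeasure_Diff_null_set)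
  finally show "emeasure M (\<phi> -` C \<inter> X0) = emeasure N C" .
qed

text \<open>Light mixing of \<open>T\<close> is applied to the \<open>\<phi>\<close>-preimages of
  \<open>A\<close> and \<open>B\<close>, which have the same measures as \<open>A\<close> and
  \<open>B\<close>. A positive liminf gives eventual positivity, the form in which mixing is later
  used for balls.\<close>

lemma lightly_mixing_isomorphic_eventually:
  assumes mix: "lightly_mixing M T" and iso: "isomorphic_systems M T N S"
    and S: "S \<in> measurable N N"
    and A: "A \<in> sets N" "emeasure N A > 0" and B: "B \<in> sets N" "emeasure N B > 0"
  shows "\<forall>\<^sub>F n in sequentially. emeasure N ((S ^^ n) -` A \<inter> space N \<inter> B) > 0"
proof -
  obtain X0 Y0 \<phi> where \<phi>: "isomorphism_mod0 M N X0 Y0 \<phi>"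
    and inv: "T ` X0 \<subseteq> X0" and conj: "\<forall>x\<in>X0. \<phi> (T x) = S (\<phi> x)"
    using iso unfolding isomorphic_systems_def by (elim exE conjE)
  have img: "\<phi> ` X0 \<subseteq> space N"
    using \<phi> by (auto simp: isomorphism_mod0_def bij_betw_def)
  \<comment> \<open>Forward invariance keeps the orbit inside \<open>X0\<close>, so the conjugacy
    can be used at every step.\<close>
  have iter: "(T ^^ n) x \<in> X0 \<and> \<phi> ((T ^^ n) x) = (S ^^ n) (\<phi> x)" if "x \<in> X0" for n x
    using that inv conj by (induction n) auto
  let ?A = "\<phi> -` A \<inter> X0" and ?B = "\<phi> -` B \<inter> X0"
  have "liminf (\<lambda>n. emeasure M (((T ^^ n) -` ?A \<inter> space M) \<inter> ?B)) > 0"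
    using A B isomorphism_mod0_vimage[OF \<phi>]
    by (intro mix[unfolded lightly_mixing_def, rule_format]) auto
  then have "\<forall>\<^sub>F n in sequentially. emeasure M (((T ^^ n) -` ?A \<inter> space M) \<inter> ?B) > 0"
    by (rule less_LiminfD)
  then show ?thesis
  proof (rule eventually_mono)
    fix n assume pos: "emeasure M (((T ^^ n) -` ?A \<inter> space M) \<inter> ?B) > 0"
    let ?C = "(S ^^ n) -` A \<inter> space N \<inter> B"
    have C: "?C \<in> sets N"
      using measurable_sets[OF measurable_compose_n[OF S] A(1)] B(1) by blast
    \<comment> \<open>An inclusion is enough, as only a lower bound for the measure of
      \<open>?C\<close> is wanted.\<close>
    have "((T ^^ n) -` ?A \<inter> space M) \<inter> ?B \<subseteq> \<phi> -` ?C \<inter> X0"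
      using iter img by auto
    then have "emeasure M (((T ^^ n) -` ?A \<inter> space M) \<inter> ?B) \<le> emeasure N ?C"
      using isomorphism_mod0_vimage[OF \<phi> C] by (metis emeasure_mono)
    with pos show "emeasure N ?C > 0" by simp
  qed
qed

text \<open>Supplies the centres of the two target balls. The conull set \<open>X0\<close> has
  positive measure and is not an atom, so it splits into two nonempty pieces; a point from each
  gives distinct images, since \<open>\<phi>\<close> is injective on \<open>X0\<close>.\<close>

lemma non_atomic_isomorphic_two_points:
  assumes na: "non_atomic M" and pos: "emeasure M (space M) > 0"
    and \<phi>: "isomorphism_mod0 M N X0 Y0 \<phi>"
  obtains p q where "p \<in> space N" "q \<in> space N" "p \<noteq> q"
proof -
  have X0: "X0 \<subseteq> space M" "space M - X0 \<in> null_sets M" and inj: "inj_on \<phi> X0"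
    and img: "\<phi> ` X0 \<subseteq> space N"
    using \<phi> by (auto simp: isomorphism_mod0_def bij_betw_def)
  have XM: "X0 \<in> sets M" using X0 by (rule conull_in_sets)
  have "X0 = space M - (space M - X0)" using X0(1) by blast
  then have "emeasure M X0 > 0"
    using pos emeasure_Diff_null_set[OF X0(2), of "space M"] by simp
  then obtain B where B: "B \<subseteq> X0" "emeasure M B \<noteq> 0" "emeasure M (X0 - B) \<noteq> 0"
    using na XM unfolding non_atomic_def by blast
  then have "B \<noteq> {}" "X0 - B \<noteq> {}" by auto
  then obtain x y where "x \<in> B" "y \<in> X0 - B" by blast
  then show thesis
    using that[of "\<phi> x" "\<phi> y"] inj img B(1) by (auto dest: inj_onD)
qed

theorem proposition2p2:
  fixes M :: "'a measure" and T :: "'a \<Rightarrow> 'a"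
  assumes "lebesgue_space M" and "non_atomic M"
    and "finite_measure M" and "emeasure M (space M) > 0"
    and "nonsingular M T"
    and "lightly_mixing M T"
  shows "measurably_sensitive TYPE('b) M T"
  unfolding measurably_sensitive_def
proof (intro allI impI)
  fix N :: "'b measure" and S d
  assume "nonsingular N S" and iso: "isomorphic_systems M T N S" and good: "good_metric N d"
  then have S: "S \<in> measurable N N" by (simp add: nonsingular_def)
  interpret Metric_space "space N" d using good by (simp add: good_metric_def)
  have open_sets: "W \<in> sets N" if "openin mtopology W" for W
    using good that by (simp add: good_metric_def regular_measure_def)
  have ball_pos: "emeasure N (mball p r) > 0" if "p \<in> space N" "r > 0" for p r
    using good that by (simp add: good_metric_def mball_eq_empty not_le)
  obtain p q where pq: "p \<in> space N" "q \<in> space N" "p \<noteq> q"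
    using iso unfolding isomorphic_systems_def
    by (elim exE conjE non_atomic_isomorphic_two_points[OF assms(2,4)])
  define \<delta> where "\<delta> = d p q / 4"
  have \<delta>: "\<delta> > 0" using pq by (simp add: \<delta>_def)
  have "\<exists>K::nat. \<forall>n\<ge>K. emeasure N {y \<in> mball x \<epsilon>. d ((S ^^ n) x) ((S ^^ n) y) > \<delta>} > 0"
    if x: "x \<in> space N" and \<epsilon>: "\<epsilon> > 0" for x \<epsilon>
  proof -
    let ?ret = "\<lambda>r n. (S ^^ n) -` mball r \<delta> \<inter> space N \<inter> mball x \<epsilon>"
    have "\<forall>\<^sub>F n in sequentially. emeasure N (?ret r n) > 0" if "r \<in> space N" for r
      using lightly_mixing_isomorphic_eventually[OF assms(6) iso S] that x \<epsilon> \<delta>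
      by (simp add: open_sets ball_pos)
    then have "\<forall>\<^sub>F n in sequentially. emeasure N (?ret p n) > 0 \<and> emeasure N (?ret q n) > 0"
      using pq by (simp add: eventually_conj)
    \<comment> \<open>Only \<open>K\<close> depends on \<open>x\<close> and
      \<open>\<epsilon>\<close>; \<open>\<delta>\<close> was fixed before them.\<close>
    then obtain K where K: "\<And>n. n \<ge> K \<Longrightarrow> emeasure N (?ret p n) > 0 \<and> emeasure N (?ret q n) > 0"
      unfolding eventually_sequentially by blast
    have "emeasure N {y \<in> mball x \<epsilon>. d ((S ^^ n) x) ((S ^^ n) y) > \<delta>} > 0" if "n \<ge> K" for n
    proof -
      define z where "z = (S ^^ n) x"
      let ?E = "{y \<in> mball x \<epsilon>. d z ((S ^^ n) y) > \<delta>}"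
      have Sn: "S ^^ n \<in> measurable N N" using S by (rule measurable_compose_n)
      have z: "z \<in> space N" using Sn x unfolding z_def by (rule measurable_space)
      \<comment> \<open>Measurability of \<open>?E\<close> matters because \<open>emeasure\<close>
        is 0 on nonmeasurable sets, which would break monotonicity. The strict inequality in
        \<open>?E\<close> is membership in the complement of a closed ball, which is open.\<close>
      have "space N - mcball z \<delta> \<in> sets N"
        using closedin_mcball[of z \<delta>] by (intro open_sets) (auto simp: closedin_def)
      then have "(S ^^ n) -` (space N - mcball z \<delta>) \<inter> space N \<inter> mball x \<epsilon> \<in> sets N"
        using measurable_sets[OF Sn] open_sets by blast
      also have "(S ^^ n) -` (space N - mcball z \<delta>) \<inter> space N \<inter> mball x \<epsilon> = ?E"
      proof (rule set_eqI)
        fix y show "y \<in> (S ^^ n) -` (space N - mcball z \<delta>) \<inter> space N \<inter> mball x \<epsilon> \<longleftrightarrow> y \<in> ?E"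
          using z measurable_space[OF Sn, of y] by (auto simp: not_le)
      qed
      finally have E: "?E \<in> sets N" .
      \<comment> \<open>Of the distance \<open>2 * \<delta>\<close> between \<open>z\<close> and
        \<open>r\<close>, the point \<open>(S ^^ n) y\<close> uses up strictly less than
        \<open>\<delta>\<close>.\<close>
      have far: "?ret r n \<subseteq> ?E" if "r \<in> space N" "d z r \<ge> 2 * \<delta>" for r
      proof
        fix y assume y: "y \<in> ?ret r n"
        then have "d z r \<le> d z ((S ^^ n) y) + d r ((S ^^ n) y)" "d r ((S ^^ n) y) < \<delta>"
          using triangle[of z "(S ^^ n) y" r] z by (auto simp: commute)
        with y that(2) show "y \<in> ?E" by auto
      qed
      \<comment> \<open>Since \<open>d p q\<close> is \<open>4 * \<delta>\<close>, one of the two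
        summands is at least half of that.\<close>
      have "d p q \<le> d z p + d z q"
        using triangle[of p z q] pq z by (simp add: commute)
      then have "d z p \<ge> 2 * \<delta> \<or> d z q \<ge> 2 * \<delta>" by (auto simp: \<delta>_def)
      then have "emeasure N ?E > 0"
      proof
        assume "d z p \<ge> 2 * \<delta>"
        then have "emeasure N (?ret p n) \<le> emeasure N ?E"
          using far pq(1) E by (intro emeasure_mono)
        with K[OF that] show ?thesis by (meson less_le_trans)
      next
        assume "d z q \<ge> 2 * \<delta>"
        then have "emeasure N (?ret q n) \<le> emeasure N ?E"
          using far pq(2) E by (intro emeasure_mono)
        with K[OF that] show ?thesis by (meson less_le_trans)
      qed
      then show ?thesis by (simp add: z_def)
    qed
    then show ?thesis by blast
  qed
  with \<delta> show "\<exists>\<delta>>0. \<forall>x\<in>space N. \<forall>\<epsilon>>0. \<exists>K::nat. \<forall>n\<ge>K.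
      emeasure N {y \<in> mball x \<epsilon>. d ((S ^^ n) x) ((S ^^ n) y) > \<delta>} > 0"
    by blast
qed

end
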